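(* Let $f:\{\pm1\}^k\to\{\pm1\}$ be a Boolean function and $p\in(0,1]$. Then $\mathbb{E}_{T\sim\mathcal{R}_p}[\mathrm{Var}[\mathsf{Bias}_T(f)]]\le p\cdot\mathrm{Var}[f]$. Furthermore, if $p\le1/3$, then $\mathbb{E}_{T\sim\mathcal{R}_p}[\mathrm{Var}[\mathsf{Bias}_T(f)]]\le\mathrm{Var}[f]^{3/2}$.
   Context: $T\sim\mathcal{R}_p$ means each $i\in[k]$ is put in $T$ independently with probability $p$. For $T\subseteq[k]$, $\mathsf{Bias}_T(f)(x)=\mathbb{E}_{y\sim U_{[k]\setminus T}}[f(\mathrm{Sel}_T(x,y))]$, where $\mathrm{Sel}_T(x,y)$ agrees with $x$ on $T$ and with $y$ elsewhere and $U_A$ is uniform on $\{\pm1\}^A$. $\mathrm{Var}[g]=\mathbb{E}[g^2]-\mathbb{E}[g]^2$ under the uniform distribution. *)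

theory Defs
  imports "HOL-Probability.Probability"
begin

text \<open>
  The set \<open>{\<plusminus>1}\<^sup>A\<close> consists of the extensional functions on \<open>A\<close> with values \<open>-1\<close> and \<open>1\<close>
  (they take the value \<open>undefined\<close> outside \<open>A\<close>), so that it is finite for finite \<open>A\<close>.
\<close>

definition cube :: "nat set \<Rightarrow> (nat \<Rightarrow> real) set" where
  "cube A = (\<Pi>\<^sub>E i\<in>A. {-1, 1})"

text \<open>\<open>pmf_of_set\<close> is the uniform distribution only on finite nonempty sets.\<close>

lemma finite_cube: "finite A \<Longrightarrow> finite (cube A)"
  by (simp add: cube_def finite_PiE)

lemma cube_nonempty: "cube A \<noteq> {}"
  by (simp add: cube_def PiE_eq_empty_iff)

definition unif :: "nat set \<Rightarrow> (nat \<Rightarrow> real) pmf" where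
  "unif A = pmf_of_set (cube A)"

definition random_subset :: "nat \<Rightarrow> real \<Rightarrow> nat set pmf" where
  "random_subset k p =
     map_pmf (\<lambda>b. {i \<in> {1..k}. b i}) (Pi_pmf {1..k} False (\<lambda>_. bernoulli_pmf p))"

text \<open>
  For \<open>T \<subseteq> A\<close>, \<open>x \<in> cube A\<close> and \<open>y \<in> cube (A - T)\<close> the result is again in \<open>cube A\<close>:
  outside \<open>A\<close> it agrees with \<open>y\<close> and hence is \<open>undefined\<close> there.
\<close>

definition Sel :: "nat set \<Rightarrow> (nat \<Rightarrow> real) \<Rightarrow> (nat \<Rightarrow> real) \<Rightarrow> (nat \<Rightarrow> real)" where
  "Sel T x y = (\<lambda>i. if i \<in> T then x i else y i)"

lemma Sel_in_cube:
  "T \<subseteq> A \<Longrightarrow> x \<in> cube A \<Longrightarrow> y \<in> cube (A - T) \<Longrightarrow> Sel T x y \<in> cube A"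
  by (fastforce simp: cube_def Sel_def PiE_iff extensional_def)

definition Bias ::
  "nat \<Rightarrow> nat set \<Rightarrow> ((nat \<Rightarrow> real) \<Rightarrow> real) \<Rightarrow> (nat \<Rightarrow> real) \<Rightarrow> real" where
  "Bias k T f x = measure_pmf.expectation (unif ({1..k} - T)) (\<lambda>y. f (Sel T x y))"

definition Var :: "nat \<Rightarrow> ((nat \<Rightarrow> real) \<Rightarrow> real) \<Rightarrow> real" where
  "Var k g = measure_pmf.expectation (unif {1..k}) (\<lambda>x. (g x)\<^sup>2)
             - (measure_pmf.expectation (unif {1..k}) g)\<^sup>2"

end

theory Submission imports Defs begin

text \<open>
  With \<open>f = (\<Sum>S. c S * walsh S)\<close>, the expected variance of \<open>Bias\<^sub>T f\<close> is
  \<open>W\<^sub>p = (\<Sum>S \<noteq> {}. p ^ card S * (c S)\<^sup>2)\<close>, so the first bound is \<open>p ^ card S \<le> p\<close>.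
  For the second, let \<open>W\<close> be the value of \<open>W\<^sub>p\<close> at \<open>p = 1/3\<close>, which is the worst case, and
  let \<open>h = (\<Sum>S \<noteq> {}. (1/3) ^ card S * c S * walsh S)\<close>.
  Bonami's inequality gives \<open>E[h^4] \<le> W\<^sup>2\<close>. Conversely \<open>E[f h] = W\<close> and \<open>E[h] = 0\<close>, and the tangent
  inequality \<open>h^4 \<ge> 4 t^3 h - 3 t^4\<close> at \<open>t = W / Var f * (f - E f)\<close>, whose two values are the optimal
  ones, yields \<open>E[h^4] \<ge> W^4 / (Var f)^3\<close>. Hence \<open>W\<^sup>2 \<le> (Var f)^3\<close>. This replaces the
  \<open>4/3\<close>-norms of the usual hypercontractive argument.
\<close>

section \<open>Characters of the cube and uniform expectations\<close>

definition walsh :: "nat set \<Rightarrow> (nat \<Rightarrow> real) \<Rightarrow> real" where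
  "walsh S x = (\<Prod>i\<in>S. x i)"

lemma walsh_empty [simp]: "walsh {} x = 1"
  by (simp add: walsh_def)

text \<open>The multilinear polynomial on \<open>cube A\<close> with Fourier coefficients
  \<open>c\<close>. With \<open>c\<close> as an argument, \<open>Bias\<close> becomes a multiplier
  acting on coefficients.\<close>

definition walsh_sum :: "nat set \<Rightarrow> (nat set \<Rightarrow> real) \<Rightarrow> (nat \<Rightarrow> real) \<Rightarrow> real" where
  "walsh_sum A c x = (\<Sum>S\<in>Pow A. c S * walsh S x)"

lemma card_cube: "finite A \<Longrightarrow> card (cube A) = 2 ^ card A"
  by (simp add: cube_def card_PiE numeral_2_eq_2)

lemma cube_values: "x \<in> cube A \<Longrightarrow> i \<in> A \<Longrightarrow> x i = -1 \<or> x i = 1"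
  by (auto simp: cube_def PiE_iff)

lemma expectation_unif:
  fixes g :: "_ \<Rightarrow> real"
  assumes "finite A"
  shows "measure_pmf.expectation (unif A) g = (\<Sum>x\<in>cube A. g x) / 2 ^ card A"
  using assms
  by (simp add: unif_def integral_pmf_of_set finite_cube cube_nonempty card_cube)

lemma set_pmf_unif: "finite A \<Longrightarrow> set_pmf (unif A) = cube A"
  by (simp add: unif_def finite_cube cube_nonempty)

lemma integrable_unif [simp]:
  "finite A \<Longrightarrow> integrable (measure_pmf (unif A)) (g :: _ \<Rightarrow> real)"
  by (rule integrable_measure_pmf_finite) (simp add: set_pmf_unif finite_cube)

lemma expectation_unif_cong:
  assumes "finite A" and "\<And>x. x \<in> cube A \<Longrightarrow> g x = (h x :: real)"
  shows "measure_pmf.expectation (unif A) g = measure_pmf.expectation (unif A) h"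
  using assms by (simp add: expectation_unif cong: sum.cong)

lemma expectation_unif_mono:
  assumes "finite A" and "\<And>x. x \<in> cube A \<Longrightarrow> g x \<le> (h x :: real)"
  shows "measure_pmf.expectation (unif A) g \<le> measure_pmf.expectation (unif A) h"
  using assms by (simp add: expectation_unif sum_mono divide_right_mono)

section \<open>Orthonormality, Parseval and Fourier inversion\<close>

lemma expectation_walsh_mult:
  assumes "finite A" and "S \<subseteq> A" and "S' \<subseteq> A"
  shows "measure_pmf.expectation (unif A) (\<lambda>x. walsh S x * walsh S' x) = of_bool (S = S')"
proof -
  let ?g = "\<lambda>i y. (if i \<in> S then y else 1) * (if i \<in> S' then y else (1::real))"
  have "walsh S x * walsh S' x = (\<Prod>i\<in>A. ?g i (x i))" for x
    using assms by (simp add: walsh_def prod.distrib prod.If_cases Int_absorb1 flip: Int_def)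
  \<comment> \<open>The sum over the cube factors over coordinates; a coordinate in exactly one of
    the two sets contributes the factor \<open>-1 + 1 = 0\<close>.\<close>
  then have "(\<Sum>x\<in>cube A. walsh S x * walsh S' x) = (\<Prod>i\<in>A. \<Sum>y\<in>{-1, 1}. ?g i y)"
    using assms(1) by (simp only: cube_def) (subst prod_sum_PiE, auto)
  also have "\<dots> = (\<Prod>i\<in>A. if (i \<in> S) = (i \<in> S') then 2 else 0)"
    by (intro prod.cong) auto
  also have "\<dots> = 2 ^ card A * of_bool (S = S')"
  proof (cases "S = S'")
    case False
    then obtain i where "i \<in> A" "(i \<in> S) \<noteq> (i \<in> S')"
      using assms(2,3) by blast
    then show ?thesis
      using assms(1) False by (auto intro!: prod_zero)
  qed simp
  finally show ?thesis
    using assms(1) by (simp add: expectation_unif)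
qed

lemma expectation_walsh:
  assumes "finite A" and "S \<subseteq> A"
  shows "measure_pmf.expectation (unif A) (walsh S) = of_bool (S = {})"
  using expectation_walsh_mult[OF assms, of "{}"] by simp

lemma expectation_walsh_sum_mult:
  assumes "finite A"
  shows "measure_pmf.expectation (unif A) (\<lambda>x. walsh_sum A c x * walsh_sum A d x)
    = (\<Sum>S\<in>Pow A. c S * d S)"
proof -
  have "measure_pmf.expectation (unif A) (\<lambda>x. walsh_sum A c x * walsh_sum A d x)
    = (\<Sum>S\<in>Pow A. \<Sum>S'\<in>Pow A. c S * d S' *
        measure_pmf.expectation (unif A) (\<lambda>x. walsh S x * walsh S' x))"
    using assms by (simp add: walsh_sum_def sum_product mult.assoc mult.left_commute[of "walsh _ _"])
  also have "\<dots> = (\<Sum>S\<in>Pow A. \<Sum>S'\<in>Pow A. c S * d S' * of_bool (S = S'))"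
    using assms by (intro sum.cong refl) (simp add: expectation_walsh_mult)
  also have "\<dots> = (\<Sum>S\<in>Pow A. c S * d S)"
    using assms by (simp add: of_bool_def if_distrib cong: if_cong)
  finally show ?thesis .
qed

lemma expectation_walsh_sum:
  assumes "finite A"
  shows "measure_pmf.expectation (unif A) (walsh_sum A c) = c {}"
proof -
  \<comment> \<open>The constant function 1 has its only nonzero coefficient at \<open>{}\<close>,
    so the mean is an inner product with it.\<close>
  have "walsh_sum A (\<lambda>S. of_bool (S = {})) x = 1" for x
    using assms by (simp add: walsh_sum_def of_bool_def if_distrib[of "\<lambda>a. a * _"]
        cong: if_cong)
  then show ?thesis
    using expectation_walsh_sum_mult[OF assms, of c "\<lambda>S. of_bool (S = {})"] assms
    by (simp add: of_bool_def if_distrib cong: if_cong)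
qed

text \<open>After exchanging the sums, the kernel summed over \<open>S\<close> factors into terms
  \<open>y i * x i + 1\<close>, equal to 2 where the points agree and 0 where they differ. It is
  therefore a scaled point mass at \<open>x\<close>.\<close>

lemma walsh_expansion:
  assumes "finite A" and "x \<in> cube A"
  shows "g x = walsh_sum A (\<lambda>S. measure_pmf.expectation (unif A) (\<lambda>y. g y * walsh S y)) x"
proof -
  have kernel: "(\<Sum>S\<in>Pow A. walsh S y * walsh S x) = 2 ^ card A * of_bool (y = x)"
    if y: "y \<in> cube A" for y
  proof -
    have "(\<Sum>S\<in>Pow A. walsh S y * walsh S x) = (\<Prod>i\<in>A. y i * x i + 1)"
      using assms(1) by (simp add: prod_add walsh_def prod.distrib)
    also have "\<dots> = 2 ^ card A * of_bool (y = x)"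
    proof (cases "y = x")
      case True
      have "(\<Prod>i\<in>A. y i * x i + 1) = (\<Prod>i\<in>A. 2)"
        using cube_values[OF assms(2)] by (intro prod.cong) (fastforce simp: True)+
      with True show ?thesis by simp
    next
      case False
      then obtain i where i: "i \<in> A" "y i \<noteq> x i"
        using PiE_ext[OF y[unfolded cube_def] assms(2)[unfolded cube_def]] by blast
      then have "y i * x i + 1 = 0"
        using cube_values[OF assms(2)] cube_values[OF y] by fastforce
      with i False show ?thesis
        using assms(1) by (auto intro!: prod_zero)
    qed
    finally show ?thesis .
  qed
  have "walsh_sum A (\<lambda>S. measure_pmf.expectation (unif A) (\<lambda>y. g y * walsh S y)) x
    = (\<Sum>S\<in>Pow A. \<Sum>y\<in>cube A. g y * (walsh S y * walsh S x)) / 2 ^ card A"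
    using assms(1)
    by (simp add: walsh_sum_def expectation_unif sum_divide_distrib sum_distrib_right mult.assoc)
  also have "\<dots> = (\<Sum>y\<in>cube A. g y * (\<Sum>S\<in>Pow A. walsh S y * walsh S x)) / 2 ^ card A"
    by (subst sum.swap) (simp add: sum_distrib_left)
  also have "\<dots> = (\<Sum>y\<in>cube A. g y * (2 ^ card A * of_bool (y = x))) / 2 ^ card A"
    by (simp add: kernel cong: sum.cong)
  also have "\<dots> = g x"
    using assms by (simp add: of_bool_def if_distrib finite_cube cong: if_cong)
  finally show ?thesis by simp
qed

section \<open>Induction on coordinates and Bonami's inequality\<close>

lemma expectation_unif_insert:
  fixes g :: "_ \<Rightarrow> real"
  assumes "finite A" and "n \<notin> A"
  shows "measure_pmf.expectation (unif (insert n A)) g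
    = measure_pmf.expectation (unif A) (\<lambda>x. (g (x(n := 1)) + g (x(n := -1))) / 2)"
proof -
  have "(\<Sum>x\<in>cube (insert n A). g x) = (\<Sum>(y, x)\<in>{-1, 1} \<times> cube A. g (x(n := y)))"
    unfolding cube_def PiE_insert_eq
    by (subst sum.reindex[OF inj_combinator[OF assms(2)]]) (simp add: case_prod_unfold)
  also have "\<dots> = (\<Sum>x\<in>cube A. g (x(n := 1)) + g (x(n := -1)))"
    by (simp add: sum.cartesian_product[symmetric] sum.distrib)
  finally show ?thesis
    using assms
    by (simp add: expectation_unif sum.distrib add_divide_distrib flip: sum_divide_distrib)
qed

lemma sum_Pow_insert:
  fixes F :: "'a set \<Rightarrow> real"
  assumes "finite A" and "n \<notin> A"
  shows "(\<Sum>S\<in>Pow (insert n A). F S) = (\<Sum>S\<in>Pow A. F S) + (\<Sum>S\<in>Pow A. F (insert n S))"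
proof -
  have "inj_on (insert n) (Pow A)"
    using assms(2) by (intro inj_onI) (metis Pow_iff insert_ident subsetD)
  moreover have "Pow A \<inter> insert n ` Pow A = {}"
    using assms(2) by auto
  ultimately show ?thesis
    using assms(1) by (simp add: Pow_insert sum.union_disjoint sum.reindex)
qed

text \<open>Multilinearity in the coordinate \<open>n\<close>: the part free of it and the cofactor
  of \<open>y\<close> are both Walsh sums over \<open>A\<close>, so an induction hypothesis over
  \<open>A\<close> applies to each.\<close>

lemma walsh_sum_insert:
  assumes "finite A" and "n \<notin> A"
  shows "walsh_sum (insert n A) c (x(n := y))
    = walsh_sum A c x + y * walsh_sum A (\<lambda>S. c (insert n S)) x"
proof -
  have "walsh S (x(n := y)) = walsh S x" "walsh (insert n S) (x(n := y)) = y * walsh S x"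
    if "S \<in> Pow A" for S
  proof -
    from that assms have "n \<notin> S" "finite S" by (auto dest: finite_subset)
    then show "walsh S (x(n := y)) = walsh S x" "walsh (insert n S) (x(n := y)) = y * walsh S x"
      by (auto simp: walsh_def intro!: prod.cong)
  qed
  then have
    "(\<Sum>S\<in>Pow A. c S * walsh S (x(n := y))) = (\<Sum>S\<in>Pow A. c S * walsh S x)"
    "(\<Sum>S\<in>Pow A. c (insert n S) * walsh (insert n S) (x(n := y)))
      = (\<Sum>S\<in>Pow A. c (insert n S) * (y * walsh S x))"
    by (auto intro!: sum.cong)
  then show ?thesis
    using assms by (simp add: walsh_sum_def sum_Pow_insert sum_distrib_left mult.left_commute)
qed

lemma expectation_unif_Cauchy_Schwarz:
  fixes g h :: "_ \<Rightarrow> real"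
  assumes "finite A"
  shows "(measure_pmf.expectation (unif A) (\<lambda>x. g x * h x))\<^sup>2
    \<le> measure_pmf.expectation (unif A) (\<lambda>x. (g x)\<^sup>2) * measure_pmf.expectation (unif A) (\<lambda>x. (h x)\<^sup>2)"
  using Cauchy_Schwarz_ineq_sum[of g h "cube A"] assms
  by (simp add: expectation_unif power_divide divide_right_mono flip: power2_eq_square)

text \<open>The (2,4)-hypercontractive inequality, with the noise operator absorbed into the weights
  \<open>3 ^ card S\<close>. Averaging over the sign of the new coordinate cancels the odd terms of
  the quartic, and Cauchy-Schwarz reduces the mixed term to fourth moments over
  \<open>A\<close>.\<close>

lemma bonami:
  assumes "finite A"
  shows "measure_pmf.expectation (unif A) (\<lambda>x. walsh_sum A c x ^ 4)
    \<le> (\<Sum>S\<in>Pow A. 3 ^ card S * (c S)\<^sup>2)\<^sup>2"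
  using assms
proof (induction A arbitrary: c rule: finite_induct)
  case empty
  show ?case
    by (simp add: expectation_unif cube_def walsh_sum_def walsh_def)
next
  case (insert n A)
  let ?E = "measure_pmf.expectation (unif A)"
  define u where "u = walsh_sum A c"
  define v where "v = walsh_sum A (\<lambda>S. c (insert n S))"
  define U where "U = (\<Sum>S\<in>Pow A. 3 ^ card S * (c S)\<^sup>2)"
  define V where "V = (\<Sum>S\<in>Pow A. 3 ^ card S * (c (insert n S))\<^sup>2)"
  have U: "?E (\<lambda>x. u x ^ 4) \<le> U\<^sup>2" and V: "?E (\<lambda>x. v x ^ 4) \<le> V\<^sup>2"
    unfolding u_def v_def U_def V_def by (rule insert.IH)+
  have nonneg: "0 \<le> U" "0 \<le> V"
    by (auto simp: U_def V_def intro!: sum_nonneg)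
  have "(?E (\<lambda>x. (u x)\<^sup>2 * (v x)\<^sup>2))\<^sup>2 \<le> ?E (\<lambda>x. ((u x)\<^sup>2)\<^sup>2) * ?E (\<lambda>x. ((v x)\<^sup>2)\<^sup>2)"
    by (rule expectation_unif_Cauchy_Schwarz) fact
  also have "\<dots> \<le> U\<^sup>2 * V\<^sup>2"
    using U V by (intro mult_mono) (auto simp flip: power_mult)
  finally have UV: "?E (\<lambda>x. (u x)\<^sup>2 * (v x)\<^sup>2) \<le> U * V"
    by (rule power2_le_imp_le[OF _ mult_nonneg_nonneg[OF nonneg], unfolded power_mult_distrib[of U]])
  have quartic: "((a + 1 * b) ^ 4 + (a + (-1) * b) ^ 4) / 2 = a ^ 4 + 6 * (a\<^sup>2 * b\<^sup>2) + b ^ 4"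
    for a b :: real
    by (simp add: power4_eq_xxxx power2_eq_square algebra_simps)
  have "measure_pmf.expectation (unif (insert n A)) (\<lambda>x. walsh_sum (insert n A) c x ^ 4)
    = ?E (\<lambda>x. u x ^ 4 + 6 * ((u x)\<^sup>2 * (v x)\<^sup>2) + v x ^ 4)"
    by (simp only: expectation_unif_insert[OF insert.hyps] walsh_sum_insert[OF insert.hyps] quartic
        flip: u_def v_def)
  also have "\<dots> = ?E (\<lambda>x. u x ^ 4) + 6 * ?E (\<lambda>x. (u x)\<^sup>2 * (v x)\<^sup>2) + ?E (\<lambda>x. v x ^ 4)"
    using insert.hyps(1) by simp
  also have "\<dots> \<le> U\<^sup>2 + 6 * (U * V) + V\<^sup>2"
    using U V UV by linarith
  \<comment> \<open>The weight 3 makes the cross terms agree, \<open>2 * 3 = 6\<close>; the slack is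
    \<open>8 * V\<^sup>2\<close>.\<close>
  also have "\<dots> \<le> (U + 3 * V)\<^sup>2"
    by (simp add: power2_eq_square algebra_simps)
  also have "U + 3 * V = (\<Sum>S\<in>Pow (insert n A). 3 ^ card S * (c S)\<^sup>2)"
  proof -
    have "card (insert n S) = Suc (card S)" if "S \<in> Pow A" for S
      using that insert.hyps by (subst card_insert_disjoint) (auto dest: finite_subset)
    then have "(\<Sum>S\<in>Pow A. 3 ^ card (insert n S) * (c (insert n S))\<^sup>2)
      = (\<Sum>S\<in>Pow A. 3 * (3 ^ card S * (c (insert n S))\<^sup>2))"
      by (intro sum.cong refl) simp
    then show ?thesis
      using insert.hyps
      by (simp add: sum_Pow_insert U_def V_def sum_distrib_left)
  qed
  finally show ?case .
qed

section \<open>Random restrictions in terms of Fourier coefficients\<close>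

lemma Bias_walsh_sum:
  assumes f: "\<And>x. x \<in> cube {1..k} \<Longrightarrow> f x = walsh_sum {1..k} c x"
    and T: "T \<subseteq> {1..k}" and x: "x \<in> cube {1..k}"
  shows "Bias k T f x = walsh_sum {1..k} (\<lambda>S. of_bool (S \<subseteq> T) * c S) x"
proof -
  let ?E = "measure_pmf.expectation (unif ({1..k} - T))"
  have split: "walsh S (Sel T x y) = walsh (S \<inter> T) x * walsh (S - T) y" if "S \<in> Pow {1..k}" for S y
  proof -
    have "finite S"
      using that by (auto dest: finite_subset)
    then show ?thesis
      unfolding walsh_def Sel_def
      by (simp add: prod.If_cases Collect_mem_eq Diff_eq)
  qed
  have "Bias k T f x = ?E (\<lambda>y. walsh_sum {1..k} c (Sel T x y))"
    unfolding Bias_def using Sel_in_cube[OF T x] f by (intro expectation_unif_cong) auto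
  also have "\<dots> = ?E (\<lambda>y. \<Sum>S\<in>Pow {1..k}. c S * walsh (S \<inter> T) x * walsh (S - T) y)"
    unfolding walsh_sum_def by (intro arg_cong[of _ _ ?E] ext sum.cong refl) (simp add: split)
  also have "\<dots> = (\<Sum>S\<in>Pow {1..k}. c S * walsh (S \<inter> T) x * ?E (walsh (S - T)))"
    by simp
  also have "\<dots> = (\<Sum>S\<in>Pow {1..k}. of_bool (S \<subseteq> T) * c S * walsh S x)"
  \<comment> \<open>The resampled factor has mean zero unless \<open>S - T\<close> is empty, and
    then \<open>S \<inter> T = S\<close>; only characters supported in \<open>T\<close>
    survive.\<close>
  proof (intro sum.cong refl)
    fix S assume "S \<in> Pow {1..k}"
    then have "?E (walsh (S - T)) = of_bool (S - T = {})"
      by (intro expectation_walsh) auto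
    then show "c S * walsh (S \<inter> T) x * ?E (walsh (S - T)) = of_bool (S \<subseteq> T) * c S * walsh S x"
      by (auto simp: Int_absorb2)
  qed
  finally show ?thesis
    by (simp add: walsh_sum_def)
qed

text \<open>Parseval: the coefficient at \<open>{}\<close> is the mean, so subtracting its square
  removes exactly that term.\<close>

lemma Var_walsh_sum:
  assumes "\<And>x. x \<in> cube {1..k} \<Longrightarrow> f x = walsh_sum {1..k} c x"
  shows "Var k f = (\<Sum>S\<in>Pow {1..k} - {{}}. (c S)\<^sup>2)"
proof -
  have "Var k f = (\<Sum>S\<in>Pow {1..k}. c S * c S) - (c {})\<^sup>2"
    unfolding Var_def
    using expectation_unif_cong[of "{1..k}" "\<lambda>x. (f x)\<^sup>2" "\<lambda>x. walsh_sum {1..k} c x * walsh_sum {1..k} c x"]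
      expectation_unif_cong[of "{1..k}" f "walsh_sum {1..k} c"] assms
    by (simp add: expectation_walsh_sum_mult expectation_walsh_sum power2_eq_square)
  also have "\<dots> = (\<Sum>S\<in>Pow {1..k} - {{}}. (c S)\<^sup>2)"
    by (subst sum.remove[of _ "{}"]) (auto simp: power2_eq_square)
  finally show ?thesis .
qed

lemma random_subset_subset: "T \<in> set_pmf (random_subset k p) \<Longrightarrow> T \<subseteq> {1..k}"
  by (auto simp: random_subset_def)

text \<open>The indicator is a product of functions of single coordinates, so independence yields
  one factor \<open>p\<close> per element of \<open>S\<close>.\<close>

lemma expectation_random_subset_superset:
  assumes "0 \<le> p" and "p \<le> 1" and "S \<subseteq> {1..k}"
  shows "measure_pmf.expectation (random_subset k p) (\<lambda>T. of_bool (S \<subseteq> T)) = p ^ card S"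
proof -
  let ?g = "\<lambda>i b. if i \<in> S then of_bool b else (1::real)"
  have fin: "finite S"
    using assms(3) by (rule finite_subset) simp
  have "of_bool (S \<subseteq> {i \<in> {1..k}. b i}) = (\<Prod>i\<in>{1..k}. ?g i (b i))" for b
  proof -
    have "(\<Prod>i\<in>{1..k}. ?g i (b i)) = (\<Prod>i\<in>S. of_bool (b i))"
      using assms(3) by (simp add: prod.If_cases Int_absorb1)
    also have "\<dots> = of_bool (\<forall>i\<in>S. b i)"
      using fin by (induction S rule: finite_induct) auto
    also have "(\<forall>i\<in>S. b i) \<longleftrightarrow> S \<subseteq> {i \<in> {1..k}. b i}"
      using assms(3) by auto
    finally show ?thesis by simp
  qed
  then have "measure_pmf.expectation (random_subset k p) (\<lambda>T. of_bool (S \<subseteq> T))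
    = measure_pmf.expectation (Pi_pmf {1..k} False (\<lambda>_. bernoulli_pmf p))
        (\<lambda>b. \<Prod>i\<in>{1..k}. ?g i (b i))"
    by (simp add: random_subset_def)
  also have "\<dots> = (\<Prod>i\<in>{1..k}. measure_pmf.expectation (bernoulli_pmf p) (?g i))"
    by (rule expectation_prod_Pi_pmf) (auto intro: integrable_measure_pmf_finite)
  also have "\<dots> = (\<Prod>i\<in>{1..k}. if i \<in> S then p else 1)"
    using assms(1,2) by (intro prod.cong refl) (simp)
  also have "\<dots> = p ^ card S"
    using assms(3) by (simp add: prod.If_cases Int_absorb1)
  finally show ?thesis .
qed

text \<open>The right-hand side is the noise stability of \<open>f\<close> at correlation
  \<open>p\<close> without its constant term.\<close>

lemma expectation_Var_Bias:
  assumes f: "\<And>x. x \<in> cube {1..k} \<Longrightarrow> f x = walsh_sum {1..k} c x"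
    and p: "0 \<le> p" "p \<le> 1"
  shows "measure_pmf.expectation (random_subset k p) (\<lambda>T. Var k (Bias k T f))
    = (\<Sum>S\<in>Pow {1..k} - {{}}. p ^ card S * (c S)\<^sup>2)"
proof -
  let ?E = "measure_pmf.expectation (random_subset k p)"
  have int: "integrable (measure_pmf (random_subset k p)) (g :: nat set \<Rightarrow> real)" for g
  proof (rule integrable_measure_pmf_finite)
    show "finite (set_pmf (random_subset k p))"
      by (rule finite_subset[of _ "Pow {1..k}"]) (use random_subset_subset in auto)
  qed
  \<comment> \<open>The multiplier is an indicator, hence its own square; the variance becomes
    linear in the events \<open>S \<subseteq> T\<close>.\<close>
  have square: "(of_bool b * a)\<^sup>2 = a\<^sup>2 * of_bool b" for a :: real and b
    by (cases b) simp_all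
  have "?E (\<lambda>T. Var k (Bias k T f)) = ?E (\<lambda>T. \<Sum>S\<in>Pow {1..k} - {{}}. (c S)\<^sup>2 * of_bool (S \<subseteq> T))"
  \<comment> \<open>The Fourier formula for \<open>Bias\<close> requires
    \<open>T \<subseteq> {1..k}\<close>, so the integrands are compared only on the support.\<close>
  proof (intro integral_cong_AE)
    show "AE T in random_subset k p.
      Var k (Bias k T f) = (\<Sum>S\<in>Pow {1..k} - {{}}. (c S)\<^sup>2 * of_bool (S \<subseteq> T))"
    proof (rule AE_pmfI)
      fix T assume "T \<in> set_pmf (random_subset k p)"
      then have "T \<subseteq> {1..k}" by (rule random_subset_subset)
      then have "Var k (Bias k T f) = (\<Sum>S\<in>Pow {1..k} - {{}}. (of_bool (S \<subseteq> T) * c S)\<^sup>2)"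
        by (intro Var_walsh_sum Bias_walsh_sum f)
      then show "Var k (Bias k T f) = (\<Sum>S\<in>Pow {1..k} - {{}}. (c S)\<^sup>2 * of_bool (S \<subseteq> T))"
        by (simp only: square)
    qed
  qed auto
  also have "\<dots> = (\<Sum>S\<in>Pow {1..k} - {{}}. (c S)\<^sup>2 * ?E (\<lambda>T. of_bool (S \<subseteq> T)))"
    by (subst Bochner_Integration.integral_sum) (simp_all only: int integral_mult_right_zero)
  also have "\<dots> = (\<Sum>S\<in>Pow {1..k} - {{}}. p ^ card S * (c S)\<^sup>2)"
    using p by (intro sum.cong refl) (simp add: expectation_random_subset_superset)
  finally show ?thesis .
qed

section \<open>Fourth-moment comparison of stability with variance\<close>

lemma quartic_tangent:
  fixes h t :: real
  shows "4 * t ^ 3 * h - 3 * t ^ 4 \<le> h ^ 4"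
proof -
  \<comment> \<open>Tangency at \<open>h = t\<close> forces the double factor; the cofactor is a sum
    of squares.\<close>
  have "h ^ 4 - (4 * t ^ 3 * h - 3 * t ^ 4) = (h - t)\<^sup>2 * ((h + t)\<^sup>2 + 2 * t\<^sup>2)"
    by (simp add: power2_eq_square power3_eq_cube power4_eq_xxxx algebra_simps)
  also have "\<dots> \<ge> 0"
    by simp
  finally show ?thesis by simp
qed

lemma stability_third_le:
  assumes f: "f \<in> cube {1..k} \<rightarrow> {-1, 1}"
    and c: "\<And>x. x \<in> cube {1..k} \<Longrightarrow> f x = walsh_sum {1..k} c x"
    and pos: "0 < Var k f"
  shows "(\<Sum>S\<in>Pow {1..k} - {{}}. (1/3) ^ card S * (c S)\<^sup>2)\<^sup>2 \<le> Var k f ^ 3"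
proof -
  let ?E = "measure_pmf.expectation (unif {1..k})"
  define W where "W = (\<Sum>S\<in>Pow {1..k} - {{}}. (1/3) ^ card S * (c S)\<^sup>2)"
  define V where "V = Var k f"
  define \<mu> where "\<mu> = ?E f"
  \<comment> \<open>The damping by 1/3 serves twice: pairing \<open>d\<close> with \<open>c\<close>
    gives \<open>W\<close>, and in \<open>bonami\<close> the weights satisfy
    \<open>3 ^ m * (1/9) ^ m = (1/3) ^ m\<close>, which gives \<open>W\<close> again.\<close>
  define d where "d S = (if S = {} then 0 else (1/3) ^ card S * c S)" for S
  define h where "h = walsh_sum {1..k} d"
  have sum_W: "(\<Sum>S\<in>Pow {1..k}. F S) = W"
    if "F {} = 0" "\<And>S. S \<noteq> {} \<Longrightarrow> F S = (1/3) ^ card S * (c S)\<^sup>2" for F :: "nat set \<Rightarrow> real"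
    using that unfolding W_def by (subst sum.remove[of _ "{}"]) auto
  have E_h: "?E h = 0"
    by (simp add: h_def expectation_walsh_sum d_def)
  have "?E (\<lambda>x. f x * h x) = ?E (\<lambda>x. walsh_sum {1..k} c x * walsh_sum {1..k} d x)"
    by (intro expectation_unif_cong) (auto simp: c h_def)
  also have "\<dots> = W"
    unfolding expectation_walsh_sum_mult[OF finite_atLeastAtMost]
    by (rule sum_W) (auto simp: d_def power2_eq_square)
  finally have E_fh: "?E (\<lambda>x. f x * h x) = W" .
  have "(\<Sum>S\<in>Pow {1..k}. 3 ^ card S * (d S)\<^sup>2) = W"
    by (rule sum_W) (auto simp: d_def power2_eq_square power_one_over field_simps)
  then have upper: "?E (\<lambda>x. h x ^ 4) \<le> W\<^sup>2"
    using bonami[of "{1..k}" d] by (simp add: h_def)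
  have sq: "(f x)\<^sup>2 = 1" if "x \<in> cube {1..k}" for x
    using f that by (auto dest!: funcset_mem)
  have "?E (\<lambda>x. (f x)\<^sup>2) = ?E (\<lambda>x. 1)"
    by (intro expectation_unif_cong) (auto simp: sq)
  then have V_eq: "V = 1 - \<mu>\<^sup>2"
    by (simp add: V_def Var_def \<mu>_def)
  \<comment> \<open>\<open>r * (f x - \<mu>)\<close> is the conditional mean of \<open>h\<close>
    given \<open>f\<close>: since \<open>V = (1 - \<mu>) * (1 + \<mu>)\<close>, its values are
    \<open>W / (1 + \<mu>)\<close> and \<open>- W / (1 - \<mu>)\<close>.\<close>
  define r where "r = W / V"
  \<comment> \<open>Chosen so that \<open>V * K\<close> is the fourth central moment of
    \<open>f\<close>.\<close>
  define K where "K = V + 4 * \<mu>\<^sup>2"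
  \<comment> \<open>These collect the terms of the tangent bound that vanish in expectation:
    \<open>?b\<close> multiplies \<open>h\<close>, which has mean 0, and \<open>?d\<close>
    multiplies \<open>f x - \<mu>\<close>.\<close>
  let ?b = "- (4 * r ^ 3 * (K * \<mu> + 2 * \<mu> * V))"
  let ?d = "3 * r ^ 4 * (4 * \<mu> * V + 8 * \<mu> ^ 3)"
  have "?E (\<lambda>x. 4 * r ^ 3 * K * (f x * h x) + ?b * h x + (- 3 * r ^ 4 * (V * K) - ?d * \<mu> + ?d * f x))
    \<le> ?E (\<lambda>x. h x ^ 4)"
  proof (rule expectation_unif_mono)
    fix x assume "x \<in> cube {1..k}"
    define e where "e = f x - \<mu>"
    \<comment> \<open>Powers of \<open>e\<close> are affine in \<open>f\<close>, so only \<open>E[f]\<close>, \<open>E[h]\<close> and \<open>E[f h]\<close> enter.\<close>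
    have e2: "e\<^sup>2 = V - 2 * \<mu> * e"
      using sq[OF \<open>x \<in> _\<close>] by (simp add: e_def V_eq power2_eq_square algebra_simps)
    have e3: "e ^ 3 = K * e - 2 * \<mu> * V"
    proof -
      have "e ^ 3 = e * e\<^sup>2"
        by (simp add: power3_eq_cube power2_eq_square)
      also have "\<dots> = e * (V - 2 * \<mu> * e)"
        by (simp only: e2)
      also have "\<dots> = V * e - 2 * \<mu> * e\<^sup>2"
        by (simp add: power2_eq_square algebra_simps)
      also have "\<dots> = V * e - 2 * \<mu> * (V - 2 * \<mu> * e)"
        by (simp only: e2)
      finally show ?thesis
        by (simp add: K_def power2_eq_square algebra_simps)
    qed
    have e4: "e ^ 4 = V * K - (4 * \<mu> * V + 8 * \<mu> ^ 3) * e"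
    proof -
      have "e ^ 4 = e * e ^ 3"
        by (simp add: power3_eq_cube power4_eq_xxxx)
      also have "\<dots> = K * e\<^sup>2 - 2 * \<mu> * V * e"
        unfolding e3 by (simp add: power2_eq_square algebra_simps)
      finally show ?thesis
        unfolding e2 by (simp add: K_def power2_eq_square power3_eq_cube algebra_simps)
    qed
    have "4 * r ^ 3 * K * (f x * h x) + ?b * h x + (- 3 * r ^ 4 * (V * K) - ?d * \<mu> + ?d * f x)
      = 4 * r ^ 3 * (K * e - 2 * \<mu> * V) * h x - 3 * r ^ 4 * (V * K - (4 * \<mu> * V + 8 * \<mu> ^ 3) * e)"
      by (simp add: e_def algebra_simps)
    also have "\<dots> = 4 * (r * e) ^ 3 * h x - 3 * (r * e) ^ 4"
      by (simp add: power_mult_distrib e3 e4)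
    also have "\<dots> \<le> h x ^ 4"
      by (rule quartic_tangent)
    finally show "4 * r ^ 3 * K * (f x * h x) + ?b * h x
      + (- 3 * r ^ 4 * (V * K) - ?d * \<mu> + ?d * f x) \<le> h x ^ 4" .
  qed simp
  also have "?E (\<lambda>x. 4 * r ^ 3 * K * (f x * h x) + ?b * h x + (- 3 * r ^ 4 * (V * K) - ?d * \<mu> + ?d * f x))
    = 4 * r ^ 3 * K * W - 3 * r ^ 4 * (V * K)"
    using E_fh E_h by (simp add: \<mu>_def)
  also have "\<dots> = K * (W ^ 4 / V ^ 3)"
    using pos by (simp add: r_def V_def field_simps power3_eq_cube power4_eq_xxxx)
  finally have "K * (W ^ 4 / V ^ 3) \<le> W\<^sup>2"
    using upper by linarith
  moreover have "1 * (W ^ 4 / V ^ 3) \<le> K * (W ^ 4 / V ^ 3)"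
  proof (rule mult_right_mono)
    show "1 \<le> K"
      by (simp add: K_def V_eq)
    show "0 \<le> W ^ 4 / V ^ 3"
      using pos by (simp add: V_def)
  qed
  ultimately have "W ^ 4 \<le> W\<^sup>2 * V ^ 3"
    using pos by (simp add: V_def pos_divide_le_eq)
  then have "W\<^sup>2 * W\<^sup>2 \<le> W\<^sup>2 * V ^ 3"
    by (simp add: power4_eq_xxxx power2_eq_square)
  \<comment> \<open>Cancelling \<open>W\<^sup>2\<close> needs \<open>W\<close> nonzero; for
    \<open>W = 0\<close> the claim is the positivity of \<open>V\<close>.\<close>
  then have "W\<^sup>2 \<le> V ^ 3"
  proof (cases "W = 0")
    case False
    with \<open>W\<^sup>2 * W\<^sup>2 \<le> W\<^sup>2 * V ^ 3\<close> show ?thesis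
      by (simp only: mult_le_cancel_left_pos zero_less_power2 not_False_eq_True)
  qed (use pos in \<open>simp add: V_def\<close>)
  then show ?thesis
    by (simp add: W_def V_def)
qed

theorem theorem3p13:
  fixes k :: nat and f :: "(nat \<Rightarrow> real) \<Rightarrow> real" and p :: real
  assumes "f \<in> cube {1..k} \<rightarrow> {-1, 1}"
    and "0 < p" and "p \<le> 1"
  shows "measure_pmf.expectation (random_subset k p) (\<lambda>T. Var k (Bias k T f)) \<le> p * Var k f \<and>
         (p \<le> 1/3 \<longrightarrow>
           measure_pmf.expectation (random_subset k p) (\<lambda>T. Var k (Bias k T f))
             \<le> Var k f powr (3/2))"
proof -
  define c where "c S = measure_pmf.expectation (unif {1..k}) (\<lambda>y. f y * walsh S y)" for S
  define W where "W q = (\<Sum>S\<in>Pow {1..k} - {{}}. q ^ card S * (c S)\<^sup>2)" for q :: real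
  have c: "f x = walsh_sum {1..k} c x" if "x \<in> cube {1..k}" for x
    unfolding c_def using that by (intro walsh_expansion) simp_all
  have E: "measure_pmf.expectation (random_subset k p) (\<lambda>T. Var k (Bias k T f)) = W p"
    unfolding W_def using assms(2,3) by (intro expectation_Var_Bias c) auto
  have Var: "Var k f = (\<Sum>S\<in>Pow {1..k} - {{}}. (c S)\<^sup>2)"
    by (intro Var_walsh_sum c)
  have "p ^ card S \<le> p" if "S \<in> Pow {1..k} - {{}}" for S
  proof -
    from that have "0 < card S"
      by (auto simp: card_gt_0_iff dest: finite_subset)
    then show ?thesis
      using power_decreasing[of 1 "card S" p] assms(2,3) by simp
  qed
  then have le: "W p \<le> p * Var k f"
    unfolding W_def Var sum_distrib_left by (intro sum_mono mult_right_mono) auto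
  have "W p \<le> Var k f powr (3/2)" if "p \<le> 1/3"
  proof (cases "Var k f > 0")
    case True
    have "W p \<le> W (1/3)"
      unfolding W_def using that assms(2) by (intro sum_mono mult_right_mono power_mono) auto
    also have "W (1/3) \<le> Var k f powr (3/2)"
    \<comment> \<open>Squaring turns the exponent \<open>3/2\<close> into the integer power bounded
      by \<open>stability_third_le\<close>.\<close>
    proof (rule power2_le_imp_le)
      have "(W (1/3))\<^sup>2 \<le> Var k f ^ 3"
        unfolding W_def using assms(1) c True by (rule stability_third_le)
      also have "\<dots> = (Var k f powr (3/2))\<^sup>2"
        using True by (simp add: powr_power)
      finally show "(W (1/3))\<^sup>2 \<le> (Var k f powr (3/2))\<^sup>2" .
    qed simp
    finally show ?thesis .
  next
    \<comment> \<open>Here the variance is 0, so the first bound gives \<open>W p \<le> 0\<close>,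
      and \<open>0 powr (3/2) = 0\<close>.\<close>
    case False
    moreover have "0 \<le> Var k f"
      unfolding Var by (simp add: sum_nonneg)
    ultimately show ?thesis
      using le by simp
  qed
  with le E show ?thesis
    by simp
qed

end
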